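(* Let $(\mathcal{X},d)$ be a complete separable metric space, let $\lambda>0$, let $c_\lambda(x,y)=\min\{d(x,y),2\lambda\}$, and let $\mu,\nu\in\mathcal{P}(\mathcal{X})$ be Borel probability measures. Then: (i) every $c_\lambda$-convex function $\psi$ on $\mathcal{X}$ coincides with its own $c_\lambda$-transform: $\psi^{c}(x)=\psi(x)$ for all $x\in\mathcal{X}$; (ii) the dual form of the robust optimal transport problem holds: $$\inf_{\pi\in\Pi(\mu,\nu)}\int_{\mathcal{X}\times\mathcal{X}}c_\lambda(x,y)\,d\pi(x,y)=\sup\left\{\int_{\mathcal{X}}\psi\,d\mu-\int_{\mathcal{X}}\psi\,d\nu:\ \psi\in C_b(\mathcal{X}),\ |\psi(x)-\psi(y)|\le d(x,y)\ \forall x,y\in\mathcal{X},\ \mathrm{range}(\psi)\le 2\lambda\right\},$$ and the supremum on the right-hand side is attained by some such $\psi$ (a Kantorovich potential).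
   Context: $\mathcal{P}(\mathcal{X})$ is the set of Borel probability measures on $\mathcal{X}$; $\Pi(\mu,\nu)$ is the set of Borel probability measures on $\mathcal{X}\times\mathcal{X}$ with first marginal $\mu$ and second marginal $\nu$; $C_b(\mathcal{X})$ is the set of bounded continuous real functions on $\mathcal{X}$; $\mathrm{range}(\psi):=\sup\psi-\inf\psi$. For a cost $c$ on $\mathcal{X}\times\mathcal{X}$, a function $\psi:\mathcal{X}\to\mathbb{R}\cup\{+\infty\}$, not identically $+\infty$, is $c$-convex if there is $\phi:\mathcal{X}\to\mathbb{R}\cup\{\pm\infty\}$ with $\psi(x)=\sup_{y\in\mathcal{X}}[\phi(y)-c(x,y)]$ for all $x$; its $c$-transform is $\psi^{c}(y)=\inf_{x\in\mathcal{X}}[\psi(x)+c(x,y)]$. *)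

theory Defs
  imports "HOL-Probability.Probability"
begin

definition borel_prob_measures :: "'a::topological_space measure set" where
  "borel_prob_measures = {\<mu>. prob_space \<mu> \<and> sets \<mu> = sets borel}"

definition couplings ::
  "'a::topological_space measure \<Rightarrow> 'a measure \<Rightarrow> ('a \<times> 'a) measure set" where
  "couplings \<mu> \<nu> =
    {\<pi> \<in> borel_prob_measures. distr \<pi> borel fst = \<mu> \<and> distr \<pi> borel snd = \<nu>}"

text \<open>The supremum and infimum are taken in the reals, so this is meaningful only for
  bounded \<open>\<psi>\<close>; it is used only on \<^term>\<open>bcontfun\<close>.\<close>

definition fun_range :: "('a \<Rightarrow> real) \<Rightarrow> real" where
  "fun_range \<psi> = (SUP x. \<psi> x) - (INF x. \<psi> x)"

text \<open>Potentials are \<^typ>\<open>ereal\<close>-valued. Costs are real-valued, so the sums and differences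
  below never have the form \<open>\<infinity> - \<infinity>\<close>.\<close>

definition c_convex :: "('a \<Rightarrow> 'a \<Rightarrow> real) \<Rightarrow> ('a \<Rightarrow> ereal) \<Rightarrow> bool" where
  "c_convex c \<psi> \<longleftrightarrow>
    (\<forall>x. \<psi> x \<noteq> -\<infinity>) \<and> (\<exists>x. \<psi> x \<noteq> \<infinity>) \<and>
    (\<exists>\<phi> :: 'a \<Rightarrow> ereal. \<forall>x. \<psi> x = (SUP y. \<phi> y - ereal (c x y)))"

definition c_transform :: "('a \<Rightarrow> 'a \<Rightarrow> real) \<Rightarrow> ('a \<Rightarrow> ereal) \<Rightarrow> 'a \<Rightarrow> ereal" where
  "c_transform c \<psi> y = (INF x. \<psi> x + ereal (c x y))"

definition robust_cost :: "real \<Rightarrow> 'a::metric_space \<Rightarrow> 'a \<Rightarrow> real" where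
  "robust_cost l x y = min (dist x y) (2 * l)"

definition dual_potentials :: "real \<Rightarrow> ('a::metric_space \<Rightarrow> real) set" where
  "dual_potentials l =
    {\<psi> \<in> bcontfun. (\<forall>x y. \<bar>\<psi> x - \<psi> y\<bar> \<le> dist x y) \<and> fun_range \<psi> \<le> 2 * l}"

definition dual_value :: "'a measure \<Rightarrow> 'a measure \<Rightarrow> ('a \<Rightarrow> real) \<Rightarrow> real" where
  "dual_value \<mu> \<nu> \<psi> = (\<integral>x. \<psi> x \<partial>\<mu>) - (\<integral>x. \<psi> x \<partial>\<nu>)"

end

theory Submission
  imports Defs "HOL-Complex_Analysis.Great_Picard"
begin

text \<open>
  The truncated distance \<open>\<rho> = min d 2l\<close> is again a metric. This is what makes a \<open>\<rho>\<close>-convex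
  function coincide with its transform: a supremum of functions \<open>\<phi> y - \<rho> x y\<close> is
  1-Lipschitz for \<open>\<rho>\<close>, and a 1-Lipschitz function is its own transform
  (\<open>c_transform_of_c_convex\<close>). For the same reason the admissible dual functions are exactly
  those that are 1-Lipschitz for \<open>\<rho>\<close> (\<open>dual_potentials_iff\<close>), so that the duality is the
  Kantorovich--Rubinstein theorem for the bounded metric \<open>\<rho>\<close>.

  Weak duality is integration of \<open>\<psi> x - \<psi> y \<le> \<rho> x y\<close>. For the converse inequality, round
  the points of the space by a Borel map \<open>r\<close> with finite range. The push-forwards of \<open>\<mu>\<close>
  and \<open>\<nu>\<close> under \<open>r\<close> live on a finite set \<open>A\<close>, where an optimal transport plan \<open>w\<close> exists by
  compactness. Optimality forces the support of \<open>w\<close> to be cyclically monotone: otherwise some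
  mass could be rerouted around a cycle at a profit (\<open>optimal_plan_cyclically_monotone\<close>).
  By Rockafellar's construction, a cyclically monotone set carries a potential \<open>\<psi>\<close>, an infimum
  over chains through that set, with \<open>\<psi> x - \<psi> y \<le> \<rho> x y\<close> everywhere and equality on the set
  (\<open>cyclically_monotone_imp_potential\<close>). Since that infimum makes sense at every point of the
  space and not only on \<open>A\<close>, the potential of the finite problem is at once admissible for the
  original one.

  The plan \<open>w\<close> lifts to a coupling of \<open>\<mu>\<close> and \<open>\<nu>\<close> themselves by spreading the mass \<open>w a b\<close> over
  the product of fibres of \<open>r\<close> proportionally to \<open>\<mu> \<Otimes> \<nu>\<close> (\<open>coupling_of_finite_plan\<close>). By the
  triangle inequality, the cost of this coupling exceeds the dual value of \<open>\<psi>\<close> by at most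
  twice the rounding errors \<open>\<integral> \<rho> x (r x)\<close> with respect to \<open>\<mu>\<close> and \<open>\<nu>\<close>
  (\<open>discretised_duality\<close>). Taking maps \<open>r\<close> that converge pointwise to the identity, these errors
  tend to 0 by dominated convergence.

  The supremum is attained (\<open>dual_attained\<close>) because a maximising sequence, normalised to
  vanish at one point, is uniformly bounded and equicontinuous; along a subsequence it converges on a countable dense
  set, hence everywhere, and dominated convergence passes to the limit in both integrals.
\<close>

section \<open>The truncated metric and its Lipschitz functions\<close>

lemma robust_cost_triangle: "0 < l \<Longrightarrow> robust_cost l x z \<le> robust_cost l x y + robust_cost l y z"
  unfolding robust_cost_def using dist_triangle[of x z y] zero_le_dist[of x y] zero_le_dist[of y z]
  by (simp add: min_def del: zero_le_dist)

lemma robust_cost_self: "0 < l \<Longrightarrow> robust_cost l x x = 0"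
  unfolding robust_cost_def by simp

lemma robust_cost_commute: "robust_cost l x y = robust_cost l y x"
  unfolding robust_cost_def by (simp add: dist_commute)

lemma robust_cost_nonneg: "0 < l \<Longrightarrow> 0 \<le> robust_cost l x y"
  unfolding robust_cost_def by simp

lemma abs_robust_cost_le: "0 < l \<Longrightarrow> \<bar>robust_cost l x y\<bar> \<le> 2 * l"
  unfolding robust_cost_def by simp

lemma robust_cost_le: "robust_cost l x y \<le> 2 * l"
  unfolding robust_cost_def by simp

text \<open>A supremum of the functions \<open>\<phi> z - c x z\<close> inherits from each of them that it grows by at most
  \<open>c y x\<close> from \<open>y\<close> to \<open>x\<close>. So no point beats \<open>x\<close> itself in the infimum that
  defines the transform at \<open>x\<close>.\<close>

lemma c_transform_of_c_convex:
  assumes \<psi>: "c_convex c \<psi>" and zero: "\<And>x. c x x = 0"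
    and tri: "\<And>x y z. c x z \<le> c x y + c y z"
  shows "c_transform c \<psi> x = \<psi> x"
proof (rule antisym)
  obtain \<phi> where \<phi>: "\<And>x. \<psi> x = (SUP y. \<phi> y - ereal (c x y))"
    using \<psi> unfolding c_convex_def by blast
  have "c_transform c \<psi> x \<le> \<psi> x + ereal (c x x)"
    unfolding c_transform_def by (rule INF_lower) simp
  then show "c_transform c \<psi> x \<le> \<psi> x" using zero by simp
  show "\<psi> x \<le> c_transform c \<psi> x"
    unfolding c_transform_def
  proof (rule INF_greatest)
    fix y
    show "\<psi> x \<le> \<psi> y + ereal (c y x)"
      unfolding \<phi>[of x]
    proof (rule SUP_least)
      fix z
      have "\<phi> z - ereal (c x z) \<le> \<phi> z - ereal (c y z) + ereal (c y x)"
        using tri[of y z x] by (cases "\<phi> z") auto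
      also have "\<dots> \<le> \<psi> y + ereal (c y x)"
        unfolding \<phi>[of y] by (intro add_right_mono SUP_upper) simp
      finally show "\<phi> z - ereal (c x z) \<le> \<psi> y + ereal (c y x)" .
    qed
  qed
qed

text \<open>The Lipschitz and range conditions together are the single condition of being 1-Lipschitz
  for the truncated metric; boundedness and continuity then come for free.\<close>

lemma dual_potentials_iff:
  "\<psi> \<in> dual_potentials l \<longleftrightarrow> (\<forall>x y. \<psi> x - \<psi> y \<le> robust_cost l x y)"
proof
  assume \<psi>: "\<psi> \<in> dual_potentials l"
  then have bnd: "bounded (range \<psi>)" by (simp add: dual_potentials_def bcontfun_def)
  show "\<forall>x y. \<psi> x - \<psi> y \<le> robust_cost l x y"
  proof (intro allI)
    fix x y
    have "\<psi> x \<le> (SUP x. \<psi> x)" by (rule cSUP_upper[OF UNIV_I bounded_imp_bdd_above[OF bnd]])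
    moreover have "(INF x. \<psi> x) \<le> \<psi> y" by (rule cINF_lower[OF bounded_imp_bdd_below[OF bnd] UNIV_I])
    moreover have "\<bar>\<psi> x - \<psi> y\<bar> \<le> dist x y" "fun_range \<psi> \<le> 2 * l"
      using \<psi> by (auto simp: dual_potentials_def)
    ultimately show "\<psi> x - \<psi> y \<le> robust_cost l x y"
      unfolding robust_cost_def fun_range_def by linarith
  qed
next
  assume *: "\<forall>x y. \<psi> x - \<psi> y \<le> robust_cost l x y"
  have le: "\<psi> x - \<psi> y \<le> dist x y" "\<psi> x - \<psi> y \<le> 2 * l" for x y
    using *[rule_format, of x y] by (auto simp: robust_cost_def)
  have lip: "\<bar>\<psi> x - \<psi> y\<bar> \<le> dist x y" for x y
    using le[of x y] le[of y x] by (simp add: dist_commute abs_le_iff)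
  then have "1-lipschitz_on UNIV \<psi>"
    by (intro lipschitz_onI) (simp_all add: dist_real_def)
  then have "continuous_on UNIV \<psi>" by (rule lipschitz_on_continuous_on)
  moreover have "bounded (range \<psi>)"
    unfolding bounded_def using le(2)
    by (intro exI[of _ "\<psi> undefined"] exI[of _ "2 * l"]) (auto simp: dist_real_def abs_le_iff minus_diff_eq)
  moreover have "(SUP x. \<psi> x) \<le> 2 * l + (INF x. \<psi> x)"
  proof (rule cSUP_least)
    fix x
    have "\<psi> x - 2 * l \<le> (INF x. \<psi> x)"
      using le(2)[of x] by (intro cINF_greatest) (auto simp: algebra_simps)
    then show "\<psi> x \<le> 2 * l + (INF x. \<psi> x)" by simp
  qed simp
  ultimately show "\<psi> \<in> dual_potentials l"
    using lip by (simp add: dual_potentials_def bcontfun_def fun_range_def)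
qed

section \<open>Cyclical monotonicity and potentials\<close>

text \<open>The cost of rerouting mass along \<open>L = [(x1, y1), ..., (xn, yn)]\<close>: every \<open>xi\<close> gives up its
  target \<open>yi\<close> and takes over the target of its predecessor (\<open>s\<close> for \<open>x1\<close>), and finally \<open>z\<close> receives
  the target \<open>yn\<close> left over. The value is the new cost minus the old one.\<close>

fun chain_cost :: "('a \<Rightarrow> 'a \<Rightarrow> real) \<Rightarrow> 'a \<Rightarrow> ('a \<times> 'a) list \<Rightarrow> 'a \<Rightarrow> real" where
  "chain_cost c s [] z = c z s"
| "chain_cost c s ((x, y) # L) z = c x s - c x y + chain_cost c y L z"

text \<open>A cycle is opened at one of its pairs \<open>(x, y)\<close>: the chain starts with the freed target \<open>y\<close> and ends
  by serving \<open>x\<close>, so the inequality compares the old cost of the whole cycle with its new one.\<close>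

definition cyclically_monotone :: "('a \<Rightarrow> 'a \<Rightarrow> real) \<Rightarrow> ('a \<times> 'a) set \<Rightarrow> bool" where
  "cyclically_monotone c S \<longleftrightarrow>
     (\<forall>(x, y)\<in>S. \<forall>L. set L \<subseteq> S \<longrightarrow> c x y \<le> chain_cost c y L x)"

lemma chain_cost_snoc:
  "chain_cost c s (L @ [(x, y)]) z = chain_cost c s L x - c x y + c z y"
  by (induction c s L x rule: chain_cost.induct) auto

lemma chain_cost_triangle:
  assumes "\<And>x y z. c x z \<le> c x y + c y z"
  shows "chain_cost c s L z' \<le> c z' z + chain_cost c s L z"
  using assms
proof (induction c s L z rule: chain_cost.induct)
  case (1 c s z)
  show ?case using "1.prems"[of z' s z] by simp
qed (auto simp: algebra_simps)

text \<open>The potential is Rockafellar's: from a base point \<open>s\<close>, take the infimum of the chain costs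
  through \<open>S\<close> that end at \<open>z\<close>. Changing the end point gives the Lipschitz bound, and prolonging a chain by
  a pair of \<open>S\<close> gives equality on that pair. Cyclical monotonicity is what keeps
  the infimum finite.\<close>

lemma cyclically_monotone_imp_potential:
  fixes c :: "'a \<Rightarrow> 'a \<Rightarrow> real"
  assumes zero: "\<And>x. c x x = 0"
    and tri: "\<And>x y z. c x z \<le> c x y + c y z"
    and mono: "cyclically_monotone c S"
  obtains f where "\<And>x y. f x - f y \<le> c x y"
    and "\<And>x y. (x, y) \<in> S \<Longrightarrow> f x - f y = c x y"
proof -
  fix s :: 'a
  define f where "f = (\<lambda>z. INF L\<in>lists S. chain_cost c s L z)"
  have ne: "lists S \<noteq> {}" by blast
  have lower: "- c s z \<le> chain_cost c s L z" if "L \<in> lists S" for L z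
  proof (cases L)
    case Nil
    then show ?thesis using tri[of s s z] zero by simp
  next
    case (Cons p L')
    obtain x y where p: "p = (x, y)" by force
    \<comment> \<open>Closing the chain at its first pair turns it into a cycle.\<close>
    have "c x y \<le> chain_cost c y L' x"
      using mono that unfolding Cons p cyclically_monotone_def by fastforce
    also have "\<dots> \<le> c x z + chain_cost c y L' z"
      by (rule chain_cost_triangle[OF tri])
    finally show ?thesis using tri[of x z s] Cons p by simp
  qed
  have bdd: "bdd_below ((\<lambda>L. chain_cost c s L z) ` lists S)" for z
    using lower by (intro bdd_belowI2[of _ "- c s z"]) auto
  have lip: "f x - f y \<le> c x y" for x y
  proof -
    have "f x - c x y \<le> chain_cost c s L y" if "L \<in> lists S" for L
      using cINF_lower[OF bdd that, of x] chain_cost_triangle[where c = c and s = s and L = L and z' = x and z = y, OF tri]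
      unfolding f_def by simp
    then have "f x - c x y \<le> f y"
      unfolding f_def by (intro cINF_greatest ne) auto
    then show ?thesis by simp
  qed
  have "f x - f y = c x y" if "(x, y) \<in> S" for x y
  proof -
    have "f y + c x y \<le> chain_cost c s L x" if "L \<in> lists S" for L
    proof -
      have "L @ [(x, y)] \<in> lists S" using that \<open>(x, y) \<in> S\<close> by simp
      from cINF_lower[OF bdd this, of y] show ?thesis
        unfolding f_def chain_cost_snoc zero by simp
    qed
    then have "f y + c x y \<le> f x"
      unfolding f_def by (intro cINF_greatest ne) auto
    with lip[of x y] show ?thesis by simp
  qed
  with lip that show thesis by blast
qed

section \<open>Kantorovich--Rubinstein duality on a finite set\<close>

definition finite_plans :: "'a set \<Rightarrow> ('a \<Rightarrow> real) \<Rightarrow> ('a \<Rightarrow> real) \<Rightarrow> ('a \<Rightarrow> 'a \<Rightarrow> real) set" where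
  "finite_plans A p q = {w. (\<forall>a\<in>A. \<forall>b\<in>A. 0 \<le> w a b) \<and>
     (\<forall>a\<in>A. (\<Sum>b\<in>A. w a b) = p a) \<and> (\<forall>b\<in>A. (\<Sum>a\<in>A. w a b) = q b)}"

definition plan_cost :: "'a set \<Rightarrow> ('a \<Rightarrow> 'a \<Rightarrow> real) \<Rightarrow> ('a \<Rightarrow> 'a \<Rightarrow> real) \<Rightarrow> real" where
  "plan_cost A c w = (\<Sum>a\<in>A. \<Sum>b\<in>A. w a b * c a b)"

lemma plan_cost_single:
  assumes "finite A" "u \<in> A" "v \<in> A"
  shows "plan_cost A c (\<lambda>a b. of_bool (u = a \<and> v = b)) = c u v"
proof -
  have "plan_cost A c (\<lambda>a b. of_bool (u = a \<and> v = b))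
      = (\<Sum>a\<in>A. if u = a then (\<Sum>b\<in>A. if v = b then c a b else 0) else 0)"
    unfolding plan_cost_def by (intro sum.cong) (auto intro!: sum.cong)
  also have "\<dots> = c u v" using assms by simp
  finally show ?thesis .
qed

lemma plan_cost_add: "plan_cost A c (\<lambda>a b. w a b + w' a b) = plan_cost A c w + plan_cost A c w'"
  unfolding plan_cost_def by (simp add: distrib_right sum.distrib)

lemma plan_cost_diff: "plan_cost A c (\<lambda>a b. w a b - w' a b) = plan_cost A c w - plan_cost A c w'"
  unfolding plan_cost_def by (simp add: left_diff_distrib sum_subtractf)

lemma plan_cost_scale: "plan_cost A c (\<lambda>a b. t * w a b) = t * plan_cost A c w"
  unfolding plan_cost_def by (simp add: sum_distrib_left mult.assoc)

text \<open>The signed change that rerouting along a chain causes in the entry \<open>(a, b)\<close> of a plan. As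
  \<open>chain_cost\<close> is linear in its cost, it is the chain cost of an indicator; the cost of the change
  is then the chain cost itself (\<open>plan_cost_chain_shift\<close>).\<close>

abbreviation chain_shift :: "'a \<Rightarrow> ('a \<times> 'a) list \<Rightarrow> 'a \<Rightarrow> 'a \<Rightarrow> 'a \<Rightarrow> real" where
  "chain_shift s L z a b \<equiv> chain_cost (\<lambda>u v. of_bool (u = a \<and> v = b)) s L z"

lemma plan_cost_chain_shift:
  assumes "finite A" "set L \<subseteq> A \<times> A" "s \<in> A" "z \<in> A"
  shows "plan_cost A c (chain_shift s L z) = chain_cost c s L z"
  using assms(2-)
proof (induction c s L z rule: chain_cost.induct)
  case (1 c s z)
  then show ?case by (simp add: plan_cost_single assms)
next
  case (2 c s x y L z)
  then show ?case by (simp add: plan_cost_single plan_cost_add plan_cost_diff assms)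
qed

lemma chain_shift_lower:
  "- (if (a, b) \<in> set L then real (length L) else 0) \<le> chain_shift s L z a b"
  by (induction "\<lambda>u v. of_bool (u = a \<and> v = b) :: real" s L z rule: chain_cost.induct)
    (auto simp: of_bool_def split: if_splits)

text \<open>Costs depending on one coordinate telescope. Such costs compute the marginals of a plan, so
  the next two lemmas say that rerouting along a closed chain preserves marginals.\<close>

lemma chain_cost_row: "chain_cost (\<lambda>u v. g u) s L z = g z"
  by (induction "\<lambda>u (v::'a). g u" s L z rule: chain_cost.induct) auto

lemma chain_cost_column: "chain_cost (\<lambda>u v. g v) s L z = g s"
  by (induction "\<lambda>(u::'a) v. g v" s L z rule: chain_cost.induct) auto

lemma plan_cost_row:
  assumes "finite A" "a \<in> A"
  shows "plan_cost A (\<lambda>u v. of_bool (u = a)) w = (\<Sum>b\<in>A. w a b)"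
proof -
  have "plan_cost A (\<lambda>u v. of_bool (u = a)) w = (\<Sum>u\<in>A. if u = a then (\<Sum>b\<in>A. w u b) else 0)"
    unfolding plan_cost_def by (intro sum.cong) auto
  then show ?thesis using assms by simp
qed

lemma plan_cost_column:
  assumes "finite A" "b \<in> A"
  shows "plan_cost A (\<lambda>u v. of_bool (v = b)) w = (\<Sum>a\<in>A. w a b)"
  unfolding plan_cost_def using assms by (intro sum.cong) auto

lemma finite_plans_iff:
  assumes "finite A"
  shows "w \<in> finite_plans A p q \<longleftrightarrow> (\<forall>a\<in>A. \<forall>b\<in>A. 0 \<le> w a b) \<and>
    (\<forall>a\<in>A. plan_cost A (\<lambda>u v. of_bool (u = a)) w = p a) \<and>
    (\<forall>b\<in>A. plan_cost A (\<lambda>u v. of_bool (v = b)) w = q b)"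
  using assms unfolding finite_plans_def by (simp add: plan_cost_row plan_cost_column)

text \<open>Rerouting an amount \<open>\<delta>\<close> of mass around a cycle of the support yields a plan with the same marginals,
  and its cost changes by \<open>\<delta>\<close> times the cost change of the cycle. Optimality forbids a negative change.\<close>

lemma optimal_plan_cyclically_monotone:
  assumes A: "finite A" and w: "w \<in> finite_plans A p q"
    and opt: "\<And>w'. w' \<in> finite_plans A p q \<Longrightarrow> plan_cost A c w \<le> plan_cost A c w'"
  shows "cyclically_monotone c {(a, b) \<in> A \<times> A. 0 < w a b}"
  unfolding cyclically_monotone_def
proof (clarify)
  fix x y L
  let ?S = "{(a, b) \<in> A \<times> A. 0 < w a b}"
  assume L: "set L \<subseteq> ?S" and xy: "x \<in> A" "y \<in> A" "0 < w x y"
  define T where "T = set ((x, y) # L)"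
  have T: "finite T" "T \<noteq> {}" "T \<subseteq> ?S" unfolding T_def using L xy by auto
  \<comment> \<open>A pair that occurs several times in the cycle loses \<open>\<delta>\<close> each time, hence the
    division by the length of the cycle.\<close>
  define \<delta> where "\<delta> = Min ((\<lambda>(a, b). w a b) ` T) / (length L + 1)"
  have "0 < Min ((\<lambda>(a, b). w a b) ` T)" using T by (subst Min_gr_iff) auto
  then have \<delta>: "0 < \<delta>" unfolding \<delta>_def by simp
  have \<delta>le: "\<delta> * (length L + 1) \<le> w a b" if "(a, b) \<in> T" for a b
  proof -
    have "Min ((\<lambda>(a, b). w a b) ` T) \<le> w a b"
      using T that by (intro Min_le) force+
    then show ?thesis unfolding \<delta>_def by simp
  qed
  define w' where "w' = (\<lambda>a b. w a b + \<delta> * (chain_shift y L x a b - of_bool (x = a \<and> y = b)))"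
  have cost: "plan_cost A k w' = plan_cost A k w + \<delta> * (chain_cost k y L x - k x y)" for k
    unfolding w'_def plan_cost_add plan_cost_scale plan_cost_diff
    using A L xy by (subst plan_cost_chain_shift) (auto simp: plan_cost_single)
  have "0 \<le> w' a b" if ab: "a \<in> A" "b \<in> A" for a b
  proof (cases "(a, b) \<in> T")
    case True
    have "- (real (length L) + 1) \<le> chain_shift y L x a b - of_bool (x = a \<and> y = b)"
      using chain_shift_lower[of a b L y x] by (auto split: if_splits)
    from mult_left_mono[OF this, of \<delta>] \<delta> \<delta>le[OF True]
    show ?thesis unfolding w'_def by (simp add: algebra_simps)
  next
    case False
    then have "0 \<le> chain_shift y L x a b - of_bool (x = a \<and> y = b)"
      using chain_shift_lower[of a b L y x] unfolding T_def by auto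
    with \<delta> w ab show ?thesis unfolding w'_def finite_plans_def by simp
  qed
  then have "w' \<in> finite_plans A p q"
    using w xy unfolding finite_plans_iff[OF A] cost
    by (simp add: chain_cost_row chain_cost_column)
  from opt[OF this] have "0 \<le> \<delta> * (chain_cost c y L x - c x y)" unfolding cost by simp
  then show "c x y \<le> chain_cost c y L x" using \<delta> by (simp add: zero_le_mult_iff)
qed

text \<open>Plans have entries in \<open>[0, 1]\<close>, so a minimising sequence of plans has a subsequence that converges
  entrywise, and all the constraints are closed.\<close>

lemma optimal_plan_exists:
  fixes c :: "'a \<Rightarrow> 'a \<Rightarrow> real"
  assumes A: "finite A" and p: "\<And>a. a \<in> A \<Longrightarrow> 0 \<le> p a" and q: "\<And>a. a \<in> A \<Longrightarrow> 0 \<le> q a"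
    and "sum p A = 1" "sum q A = 1"
  obtains w where "w \<in> finite_plans A p q"
    and "\<And>w'. w' \<in> finite_plans A p q \<Longrightarrow> plan_cost A c w \<le> plan_cost A c w'"
proof -
  let ?P = "finite_plans A p q"
  have ub: "w a b \<le> 1" if "w \<in> ?P" "a \<in> A" "b \<in> A" for w a b
  proof -
    have "w a b \<le> (\<Sum>b\<in>A. w a b)" using that A
      by (intro member_le_sum) (auto simp: finite_plans_def)
    also have "\<dots> = p a" using that by (auto simp: finite_plans_def)
    also have "\<dots> \<le> sum p A" using that A p by (intro member_le_sum) auto
    finally show ?thesis using assms by simp
  qed
  \<comment> \<open>The independent plan shows that the set of plans is nonempty.\<close>
  have "(\<lambda>a b. p a * q b) \<in> ?P"
    using assms unfolding finite_plans_def
    by (auto simp: sum_distrib_left[symmetric] sum_distrib_right[symmetric])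
  then have ne: "plan_cost A c ` ?P \<noteq> {}" by blast
  have abs_le: "\<bar>w a b\<bar> \<le> 1" if "w \<in> ?P" "a \<in> A" "b \<in> A" for w a b
    using ub[OF that] that by (auto simp: finite_plans_def)
  have bdd: "bdd_below (plan_cost A c ` ?P)"
  proof (rule bdd_belowI2)
    fix w assume w: "w \<in> ?P"
    have "\<bar>plan_cost A c w\<bar> \<le> (\<Sum>a\<in>A. \<Sum>b\<in>A. \<bar>w a b * c a b\<bar>)"
      unfolding plan_cost_def by (intro order.trans[OF sum_abs] sum_mono sum_abs)
    also have "\<dots> \<le> (\<Sum>a\<in>A. \<Sum>b\<in>A. \<bar>c a b\<bar>)"
      using abs_le[OF w] by (intro sum_mono) (simp add: abs_mult mult_left_le_one_le)
    finally show "- (\<Sum>a\<in>A. \<Sum>b\<in>A. \<bar>c a b\<bar>) \<le> plan_cost A c w" by simp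
  qed
  obtain u where u: "\<And>n. u n \<in> plan_cost A c ` ?P" "u \<longlonglongrightarrow> Inf (plan_cost A c ` ?P)"
    using closure_contains_Inf[OF ne bdd] unfolding closure_sequential by blast
  then have "\<forall>n. \<exists>w. w \<in> ?P \<and> u n = plan_cost A c w" by blast
  then obtain W where W: "\<And>n. W n \<in> ?P" "\<And>n. u n = plan_cost A c (W n)" by metis
  obtain k :: "nat \<Rightarrow> nat" where k: "strict_mono k"
    and conv: "\<And>x. x \<in> A \<times> A \<Longrightarrow> \<exists>l. (\<lambda>n. case x of (a, b) \<Rightarrow> W (k n) a b) \<longlonglongrightarrow> l"
  proof (rule function_convergent_subsequence[of "A \<times> A" "\<lambda>n (a, b). W n a b" 1])
    show "countable (A \<times> A)" using A by (simp add: countable_finite)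
    show "norm (case x of (a, b) \<Rightarrow> W n a b) \<le> 1" if "x \<in> A \<times> A" for n x
      using abs_le[OF W(1)] that by auto
  qed blast
  define w where "w = (\<lambda>a b. lim (\<lambda>n. W (k n) a b))"
  have lim: "(\<lambda>n. W (k n) a b) \<longlonglongrightarrow> w a b" if "a \<in> A" "b \<in> A" for a b
    using conv[of "(a, b)"] that unfolding w_def by (simp add: convergent_def convergent_LIMSEQ_iff[symmetric])
  have cost_lim: "(\<lambda>n. plan_cost A g (W (k n))) \<longlonglongrightarrow> plan_cost A g w" for g
    unfolding plan_cost_def by (intro tendsto_sum tendsto_mult tendsto_const lim)
  have wP: "w \<in> ?P"
    unfolding finite_plans_iff[OF A]
  proof (intro conjI ballI)
    fix a b assume "a \<in> A" "b \<in> A"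
    then show "0 \<le> w a b" using W
      by (intro LIMSEQ_le_const[OF lim]) (auto simp: finite_plans_def)
  next
    fix a assume a: "a \<in> A"
    show "plan_cost A (\<lambda>u v. of_bool (u = a)) w = p a"
      using W a unfolding finite_plans_iff[OF A]
      by (intro LIMSEQ_unique[OF cost_lim]) auto
    show "plan_cost A (\<lambda>u v. of_bool (v = a)) w = q a"
      using W a unfolding finite_plans_iff[OF A]
      by (intro LIMSEQ_unique[OF cost_lim]) auto
  qed
  have "plan_cost A c w = Inf (plan_cost A c ` ?P)"
    using LIMSEQ_subseq_LIMSEQ[OF u(2) k] cost_lim[of c] W(2)
    by (auto simp: o_def intro: LIMSEQ_unique)
  then show thesis
    using that[OF wP] cINF_lower[OF bdd] by simp
qed

text \<open>The increments of the potential are bounded by \<open>c\<close> on the whole type, although the plan lives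
  on the finite set \<open>A\<close>; this saves extending the potential later. Primal and dual values agree
  because the plan charges only pairs on which the bound is an equality.\<close>

lemma finite_kantorovich_rubinstein:
  fixes c :: "'a \<Rightarrow> 'a \<Rightarrow> real"
  assumes A: "finite A" and "\<And>a. a \<in> A \<Longrightarrow> 0 \<le> p a" "\<And>a. a \<in> A \<Longrightarrow> 0 \<le> q a"
    and "sum p A = 1" "sum q A = 1"
    and zero: "\<And>x. c x x = 0" and tri: "\<And>x y z. c x z \<le> c x y + c y z"
  obtains w f where "w \<in> finite_plans A p q" and "\<And>x y. f x - f y \<le> c x y"
    and "plan_cost A c w = (\<Sum>a\<in>A. f a * p a) - (\<Sum>a\<in>A. f a * q a)"
proof -
  obtain w where w: "w \<in> finite_plans A p q"
    and opt: "\<And>w'. w' \<in> finite_plans A p q \<Longrightarrow> plan_cost A c w \<le> plan_cost A c w'"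
    using optimal_plan_exists[OF assms(1-5)] by blast
  obtain f where f: "\<And>x y. f x - f y \<le> c x y"
    and eq: "\<And>x y. (x, y) \<in> {(a, b) \<in> A \<times> A. 0 < w a b} \<Longrightarrow> f x - f y = c x y"
    using cyclically_monotone_imp_potential[OF zero tri optimal_plan_cyclically_monotone[OF A w opt]]
    by blast
  have "plan_cost A c w = (\<Sum>a\<in>A. \<Sum>b\<in>A. w a b * f a - w a b * f b)"
    unfolding plan_cost_def
  proof (intro sum.cong refl)
    fix a b assume "a \<in> A" "b \<in> A"
    then have "0 \<le> w a b" "0 < w a b \<Longrightarrow> f a - f b = c a b"
      using w eq by (auto simp: finite_plans_def)
    then show "w a b * c a b = w a b * f a - w a b * f b"
      by (cases "w a b = 0") (auto simp: right_diff_distrib[symmetric])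
  qed
  also have "\<dots> = (\<Sum>a\<in>A. f a * (\<Sum>b\<in>A. w a b)) - (\<Sum>a\<in>A. \<Sum>b\<in>A. w a b * f b)"
    by (simp add: sum_subtractf sum_distrib_left mult.commute)
  also have "(\<Sum>a\<in>A. \<Sum>b\<in>A. w a b * f b) = (\<Sum>b\<in>A. f b * (\<Sum>a\<in>A. w a b))"
    by (subst sum.swap) (simp add: sum_distrib_left mult.commute)
  finally have "plan_cost A c w = (\<Sum>a\<in>A. f a * p a) - (\<Sum>a\<in>A. f a * q a)"
    using w by (simp add: finite_plans_def)
  with w f that show thesis by blast
qed

section \<open>Lifting a finite plan to a coupling\<close>

lemma integral_simple_comp:
  fixes f :: "'b \<Rightarrow> real"
  assumes "finite_measure M" "finite A" "\<And>x. x \<in> space M \<Longrightarrow> r x \<in> A"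
    and meas: "\<And>a. a \<in> A \<Longrightarrow> r -` {a} \<inter> space M \<in> sets M"
  shows "(\<integral>x. f (r x) \<partial>M) = (\<Sum>a\<in>A. f a * measure M (r -` {a} \<inter> space M))"
proof -
  interpret finite_measure M by fact
  have "(\<integral>x. f (r x) \<partial>M) = (\<integral>x. (\<Sum>a\<in>A. f a * indicator (r -` {a} \<inter> space M) x) \<partial>M)"
  proof (intro Bochner_Integration.integral_cong refl)
    fix x assume x: "x \<in> space M"
    have "(\<Sum>a\<in>A. f a * indicator (r -` {a} \<inter> space M) x) = (\<Sum>a\<in>A. if r x = a then f a else 0)"
      using x by (intro sum.cong) (auto simp: indicator_def)
    then show "f (r x) = (\<Sum>a\<in>A. f a * indicator (r -` {a} \<inter> space M) x)"
      using assms(2) assms(3)[OF x] by simp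
  qed
  also have "\<dots> = (\<Sum>a\<in>A. (\<integral>x. f a * indicator (r -` {a} \<inter> space M) x \<partial>M))"
    using meas by (intro Bochner_Integration.integral_sum) (auto simp: emeasure_eq_measure)
  also have "\<dots> = (\<Sum>a\<in>A. f a * measure M (r -` {a} \<inter> space M))"
    by (intro sum.cong refl) (simp add: Int_absorb2)
  finally show ?thesis .
qed

lemma sum_measure_fibres:
  assumes "finite_measure M" "finite A" "\<And>x. r x \<in> A" "B \<in> sets M"
    and "\<And>a. a \<in> A \<Longrightarrow> r -` {a} \<inter> B \<in> sets M"
  shows "(\<Sum>a\<in>A. measure M (r -` {a} \<inter> B)) = measure M B"
proof -
  interpret finite_measure M by fact
  have "measure M (\<Union>a\<in>A. r -` {a} \<inter> B) = (\<Sum>a\<in>A. measure M (r -` {a} \<inter> B))"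
    using assms by (intro finite_measure_finite_Union) (auto simp: disjoint_family_on_def)
  moreover have "(\<Union>a\<in>A. r -` {a} \<inter> B) = B" using assms(3) by auto
  ultimately show ?thesis by simp
qed

text \<open>The mass \<open>w a b\<close> is spread over the rectangle of fibres proportionally to the product measure: the coupling
  has the density \<open>w a b / (p a * q b)\<close> there. Fibres of measure 0 carry no mass of
  \<open>w\<close>, so on them the convention \<open>x / 0 = 0\<close> gives the right value.\<close>

lemma coupling_of_finite_plan:
  fixes \<mu> \<nu> :: "'a::second_countable_topology measure" and r :: "'a \<Rightarrow> 'b"
  assumes \<mu>: "\<mu> \<in> borel_prob_measures" and \<nu>: "\<nu> \<in> borel_prob_measures"
    and A: "finite A" and rA: "\<And>x. r x \<in> A" and r: "\<And>a. r -` {a} \<in> sets borel"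
    and w: "w \<in> finite_plans A (\<lambda>a. measure \<mu> (r -` {a})) (\<lambda>b. measure \<nu> (r -` {b}))"
  obtains \<pi> where "\<pi> \<in> couplings \<mu> \<nu>"
    and "\<And>a b. a \<in> A \<Longrightarrow> b \<in> A \<Longrightarrow> measure \<pi> (r -` {a} \<times> r -` {b}) = w a b"
proof -
  interpret \<mu>: prob_space \<mu> using \<mu> by (simp add: borel_prob_measures_def)
  interpret \<nu>: prob_space \<nu> using \<nu> by (simp add: borel_prob_measures_def)
  have sets[measurable_cong]: "sets \<mu> = sets borel" "sets \<nu> = sets borel"
    using \<mu> \<nu> by (auto simp: borel_prob_measures_def)
  have spaces: "space \<mu> = UNIV" "space \<nu> = UNIV"
    using sets_eq_imp_space_eq[OF sets(1)] sets_eq_imp_space_eq[OF sets(2)] by auto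
  have sets_prod: "sets (\<mu> \<Otimes>\<^sub>M \<nu>) = sets borel"
    unfolding borel_prod[symmetric] by (intro sets_pair_measure_cong sets)
  define p where "p = (\<lambda>a. measure \<mu> (r -` {a}))"
  define q where "q = (\<lambda>b. measure \<nu> (r -` {b}))"
  have w0: "\<And>a b. a \<in> A \<Longrightarrow> b \<in> A \<Longrightarrow> 0 \<le> w a b"
    and wp: "\<And>a. a \<in> A \<Longrightarrow> (\<Sum>b\<in>A. w a b) = p a"
    and wq: "\<And>b. b \<in> A \<Longrightarrow> (\<Sum>a\<in>A. w a b) = q b"
    using w by (auto simp: finite_plans_def p_def q_def)
  have wp0: "w a b = 0" if "a \<in> A" "b \<in> A" "p a = 0" for a b
    using wp[OF that(1)] that A w0 by (simp add: sum_nonneg_eq_0_iff)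
  have wq0: "w a b = 0" if "a \<in> A" "b \<in> A" "q b = 0" for a b
    using wq[OF that(2)] that A w0 by (simp add: sum_nonneg_eq_0_iff)
  define k where "k = (\<lambda>a b. w a b / (p a * q b))"
  have k0: "0 \<le> k a b" if "a \<in> A" "b \<in> A" for a b
    using w0[OF that] by (simp add: k_def p_def q_def)
  have kpq: "k a b * p a * q b = w a b" if "a \<in> A" "b \<in> A" for a b
    using wp0[OF that] wq0[OF that] by (auto simp: k_def)
  define h where "h = (\<lambda>z. \<Sum>(a, b)\<in>A \<times> A. ennreal (k a b) * indicator (r -` {a} \<times> r -` {b}) z)"
  define \<pi> where "\<pi> = density (\<mu> \<Otimes>\<^sub>M \<nu>) h"
  have rect: "B \<times> C \<in> sets (\<mu> \<Otimes>\<^sub>M \<nu>)" if "B \<in> sets borel" "C \<in> sets borel" for B C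
    using that by (intro pair_measureI) (auto simp: sets)
  have h[measurable]: "h \<in> borel_measurable (\<mu> \<Otimes>\<^sub>M \<nu>)"
  proof -
    have [measurable]: "r -` {a} \<times> r -` {b} \<in> sets (\<mu> \<Otimes>\<^sub>M \<nu>)" for a b by (intro rect r)
    show ?thesis unfolding h_def case_prod_beta by measurable
  qed
  have sets_\<pi>: "sets \<pi> = sets borel" unfolding \<pi>_def using sets_prod by simp
  have key: "emeasure \<pi> (B \<times> C)
      = ennreal (\<Sum>a\<in>A. \<Sum>b\<in>A. k a b * measure \<mu> (r -` {a} \<inter> B) * measure \<nu> (r -` {b} \<inter> C))"
    if [measurable]: "B \<in> sets borel" "C \<in> sets borel" for B C
  proof -
    have "emeasure \<pi> (B \<times> C) = (\<integral>\<^sup>+z. h z * indicator (B \<times> C) z \<partial>(\<mu> \<Otimes>\<^sub>M \<nu>))"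
      unfolding \<pi>_def by (intro emeasure_density h rect that)
    also have "\<dots> = (\<integral>\<^sup>+z. (\<Sum>(a, b)\<in>A \<times> A. ennreal (k a b) *
        indicator ((r -` {a} \<inter> B) \<times> (r -` {b} \<inter> C)) z) \<partial>(\<mu> \<Otimes>\<^sub>M \<nu>))"
      unfolding h_def sum_distrib_right
      by (intro nn_integral_cong sum.cong refl) (auto simp: indicator_def)
    also have "\<dots> = (\<Sum>(a, b)\<in>A \<times> A. ennreal (k a b) *
        emeasure (\<mu> \<Otimes>\<^sub>M \<nu>) ((r -` {a} \<inter> B) \<times> (r -` {b} \<inter> C)))"
      unfolding case_prod_beta using rect r
      by (subst nn_integral_sum) (auto intro!: sum.cong simp: nn_integral_cmult)
    also have "\<dots> = (\<Sum>(a, b)\<in>A \<times> A. ennreal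
        (k a b * measure \<mu> (r -` {a} \<inter> B) * measure \<nu> (r -` {b} \<inter> C)))"
      using r that k0
      by (intro sum.cong) (auto simp: sets \<nu>.emeasure_pair_measure_Times
          \<mu>.emeasure_eq_measure \<nu>.emeasure_eq_measure ennreal_mult mult.assoc)
    also have "\<dots> = ennreal (\<Sum>(a, b)\<in>A \<times> A.
        k a b * measure \<mu> (r -` {a} \<inter> B) * measure \<nu> (r -` {b} \<inter> C))"
      unfolding case_prod_beta using k0 by (intro sum_ennreal) auto
    finally show ?thesis by (simp add: sum.cartesian_product)
  qed
  have fst_marg: "emeasure \<pi> (B \<times> UNIV) = emeasure \<mu> B" if B[measurable]: "B \<in> sets borel" for B
  proof -
    have "(\<Sum>b\<in>A. k a b * measure \<mu> (r -` {a} \<inter> B) * q b) = measure \<mu> (r -` {a} \<inter> B)"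
      if a: "a \<in> A" for a
    proof (cases "p a = 0")
      case True
      have "measure \<mu> (r -` {a} \<inter> B) \<le> p a"
        unfolding p_def using r by (intro \<mu>.finite_measure_mono) (auto simp: sets)
      then have "measure \<mu> (r -` {a} \<inter> B) = 0" using True by (simp add: measure_le_0_iff)
      then show ?thesis by simp
    next
      case False
      have "(\<Sum>b\<in>A. k a b * measure \<mu> (r -` {a} \<inter> B) * q b)
          = (\<Sum>b\<in>A. w a b) * measure \<mu> (r -` {a} \<inter> B) / p a"
        unfolding sum_distrib_right sum_divide_distrib using False
        by (intro sum.cong) (auto simp: kpq[OF a, symmetric])
      then show ?thesis using wp[OF a] False by simp
    qed
    then have "emeasure \<pi> (B \<times> UNIV) = ennreal (\<Sum>a\<in>A. measure \<mu> (r -` {a} \<inter> B))"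
      using key[OF B, of UNIV] by (simp add: q_def)
    also have "\<dots> = emeasure \<mu> B"
      unfolding \<mu>.emeasure_eq_measure using r A rA
      by (subst sum_measure_fibres) (auto simp: sets \<mu>.finite_measure_axioms)
    finally show ?thesis .
  qed
  have snd_marg: "emeasure \<pi> (UNIV \<times> C) = emeasure \<nu> C" if C[measurable]: "C \<in> sets borel" for C
  proof -
    have "(\<Sum>a\<in>A. k a b * p a * measure \<nu> (r -` {b} \<inter> C)) = measure \<nu> (r -` {b} \<inter> C)"
      if b: "b \<in> A" for b
    proof (cases "q b = 0")
      case True
      have "measure \<nu> (r -` {b} \<inter> C) \<le> q b"
        unfolding q_def using r by (intro \<nu>.finite_measure_mono) (auto simp: sets)
      then have "measure \<nu> (r -` {b} \<inter> C) = 0" using True by (simp add: measure_le_0_iff)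
      then show ?thesis by simp
    next
      case False
      have "(\<Sum>a\<in>A. k a b * p a * measure \<nu> (r -` {b} \<inter> C))
          = (\<Sum>a\<in>A. w a b) * measure \<nu> (r -` {b} \<inter> C) / q b"
        unfolding sum_distrib_right sum_divide_distrib using False
        by (intro sum.cong) (auto simp: kpq[OF _ b, symmetric])
      then show ?thesis using wq[OF b] False by simp
    qed
    moreover have "emeasure \<pi> (UNIV \<times> C)
        = ennreal (\<Sum>b\<in>A. \<Sum>a\<in>A. k a b * p a * measure \<nu> (r -` {b} \<inter> C))"
      using key[OF _ C, of UNIV] by (subst sum.swap) (simp add: p_def)
    ultimately have "emeasure \<pi> (UNIV \<times> C) = ennreal (\<Sum>b\<in>A. measure \<nu> (r -` {b} \<inter> C))"
      by simp
    also have "\<dots> = emeasure \<nu> C"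
      unfolding \<nu>.emeasure_eq_measure using r A rA
      by (subst sum_measure_fibres) (auto simp: sets \<nu>.finite_measure_axioms)
    finally show ?thesis .
  qed
  have space_\<pi>: "space \<pi> = UNIV" using sets_eq_imp_space_eq[OF sets_\<pi>] by simp
  have "emeasure \<pi> (space \<pi>) = 1"
    using fst_marg[of UNIV] \<mu>.emeasure_space_1 by (simp add: space_\<pi> spaces)
  then have "\<pi> \<in> borel_prob_measures"
    unfolding borel_prob_measures_def using sets_\<pi> by (auto intro: prob_spaceI)
  moreover have "distr \<pi> borel fst = \<mu>"
  proof (rule measure_eqI)
    fix B assume "B \<in> sets (distr \<pi> borel fst)"
    then have B: "B \<in> sets borel" by simp
    have "fst \<in> measurable \<pi> borel"
      by (subst measurable_cong_sets[OF sets_\<pi> refl]) (intro borel_measurable_continuous_onI continuous_intros)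
    then have "emeasure (distr \<pi> borel fst) B = emeasure \<pi> (B \<times> UNIV)"
      using B by (auto simp: emeasure_distr space_\<pi> intro!: arg_cong2[where f = emeasure])
    then show "emeasure (distr \<pi> borel fst) B = emeasure \<mu> B" using fst_marg[OF B] by simp
  qed (simp add: sets)
  moreover have "distr \<pi> borel snd = \<nu>"
  proof (rule measure_eqI)
    fix B assume "B \<in> sets (distr \<pi> borel snd)"
    then have B: "B \<in> sets borel" by simp
    have "snd \<in> measurable \<pi> borel"
      by (subst measurable_cong_sets[OF sets_\<pi> refl]) (intro borel_measurable_continuous_onI continuous_intros)
    then have "emeasure (distr \<pi> borel snd) B = emeasure \<pi> (UNIV \<times> B)"
      using B by (auto simp: emeasure_distr space_\<pi> intro!: arg_cong2[where f = emeasure])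
    then show "emeasure (distr \<pi> borel snd) B = emeasure \<nu> B" using snd_marg[OF B] by simp
  qed (simp add: sets)
  ultimately have "\<pi> \<in> couplings \<mu> \<nu>" by (simp add: couplings_def)
  moreover have "measure \<pi> (r -` {a} \<times> r -` {b}) = w a b" if ab: "a \<in> A" "b \<in> A" for a b
  proof -
    have fib: "r -` {a'} \<inter> r -` {a} = (if a' = a then r -` {a} else {})" for a a' by auto
    have "(\<Sum>a'\<in>A. \<Sum>b'\<in>A. k a' b' * measure \<mu> (r -` {a'} \<inter> r -` {a}) * measure \<nu> (r -` {b'} \<inter> r -` {b}))
        = (\<Sum>a'\<in>A. if a' = a then (\<Sum>b'\<in>A. if b' = b then k a b * p a * q b else 0) else 0)"
      unfolding fib p_def q_def by (intro sum.cong refl) (auto intro!: sum.cong)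
    also have "\<dots> = w a b" using ab A kpq by simp
    finally show ?thesis
      using key[OF r[of a] r[of b]] w0[OF ab] by (simp add: measure_def)
  qed
  ultimately show thesis using that by blast
qed

section \<open>Weak duality\<close>

lemma robust_cost_measurable [measurable]:
  fixes f g :: "'b \<Rightarrow> 'a::{second_countable_topology, metric_space}"
  assumes [measurable]: "f \<in> borel_measurable M" "g \<in> borel_measurable M"
  shows "(\<lambda>x. robust_cost l (f x) (g x)) \<in> borel_measurable M"
  unfolding robust_cost_def by measurable

lemma robust_cost_integrable:
  fixes f g :: "'b \<Rightarrow> 'a::{second_countable_topology, metric_space}"
  assumes "0 < l" "prob_space M" and [measurable]: "f \<in> borel_measurable M" "g \<in> borel_measurable M"
  shows "integrable M (\<lambda>x. robust_cost l (f x) (g x))"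
proof -
  interpret prob_space M by fact
  show ?thesis
    by (intro integrable_const_bound[of _ "2 * l"]) (auto simp: abs_robust_cost_le[OF \<open>0 < l\<close>])
qed

lemma dual_potential_measurable:
  "\<psi> \<in> dual_potentials l \<Longrightarrow> \<psi> \<in> borel_measurable borel"
  by (auto simp: dual_potentials_def bcontfun_def intro: borel_measurable_continuous_onI)

lemma dual_potential_integrable:
  assumes "\<psi> \<in> dual_potentials l" "\<mu> \<in> borel_prob_measures"
  shows "integrable \<mu> \<psi>"
proof -
  interpret prob_space \<mu> using assms by (simp add: borel_prob_measures_def)
  obtain B where "\<And>x. norm (\<psi> x) \<le> B"
    using assms(1) by (auto simp: dual_potentials_def bcontfun_def bounded_iff)
  moreover have "\<psi> \<in> borel_measurable \<mu>"
    using assms dual_potential_measurable[OF assms(1)]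
    by (simp add: borel_prob_measures_def cong: measurable_cong_sets)
  ultimately show ?thesis by (intro integrable_const_bound[of _ B]) auto
qed

lemma coupling_facts:
  assumes "\<pi> \<in> couplings \<mu> \<nu>"
  shows "prob_space \<pi>" "sets \<pi> = sets borel"
    "fst \<in> borel_measurable \<pi>" "snd \<in> borel_measurable \<pi>"
    "distr \<pi> borel fst = \<mu>" "distr \<pi> borel snd = \<nu>"
proof -
  show sets: "sets \<pi> = sets borel" using assms by (auto simp: couplings_def borel_prob_measures_def)
  show "fst \<in> borel_measurable \<pi>" "snd \<in> borel_measurable \<pi>"
    unfolding measurable_cong_sets[OF sets refl]
    by (intro borel_measurable_continuous_onI continuous_intros)+
qed (use assms in \<open>auto simp: couplings_def borel_prob_measures_def\<close>)

lemma coupling_integral_marginals: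
  fixes f :: "'a::topological_space \<Rightarrow> real"
  assumes "\<pi> \<in> couplings \<mu> \<nu>" and f: "f \<in> borel_measurable borel"
  shows "(\<integral>p. f (fst p) \<partial>\<pi>) = (\<integral>x. f x \<partial>\<mu>)" "(\<integral>p. f (snd p) \<partial>\<pi>) = (\<integral>x. f x \<partial>\<nu>)"
    and "integrable \<mu> f \<Longrightarrow> integrable \<pi> (\<lambda>p. f (fst p))"
    and "integrable \<nu> f \<Longrightarrow> integrable \<pi> (\<lambda>p. f (snd p))"
  using integral_distr[OF coupling_facts(3)[OF assms(1)] f]
    integral_distr[OF coupling_facts(4)[OF assms(1)] f]
    integrable_distr_eq[OF coupling_facts(3)[OF assms(1)] f]
    integrable_distr_eq[OF coupling_facts(4)[OF assms(1)] f]
    coupling_facts(5,6)[OF assms(1)] by simp_all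

lemma weak_duality:
  fixes \<mu> \<nu> :: "'a::{second_countable_topology, metric_space} measure"
  assumes "0 < l" "\<mu> \<in> borel_prob_measures" "\<nu> \<in> borel_prob_measures"
    and \<pi>: "\<pi> \<in> couplings \<mu> \<nu>" and \<psi>: "\<psi> \<in> dual_potentials l"
  shows "dual_value \<mu> \<nu> \<psi> \<le> (\<integral>p. robust_cost l (fst p) (snd p) \<partial>\<pi>)"
proof -
  note marg = coupling_integral_marginals[OF \<pi> dual_potential_measurable[OF \<psi>]]
  note int = marg(3)[OF dual_potential_integrable[OF \<psi> assms(2)]]
    marg(4)[OF dual_potential_integrable[OF \<psi> assms(3)]]
  have "dual_value \<mu> \<nu> \<psi> = (\<integral>p. \<psi> (fst p) - \<psi> (snd p) \<partial>\<pi>)"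
    using int by (simp add: dual_value_def marg(1,2))
  also have "\<dots> \<le> (\<integral>p. robust_cost l (fst p) (snd p) \<partial>\<pi>)"
    using \<psi> unfolding dual_potentials_iff
    by (intro integral_mono Bochner_Integration.integrable_diff int robust_cost_integrable assms
        coupling_facts(1,3,4)[OF \<pi>]) auto
  finally show ?thesis .
qed

section \<open>Duality up to a rounding error\<close>

text \<open>Couple \<open>\<mu>\<close> and \<open>\<nu>\<close> through an optimal plan of the rounded problem. Replacing both points
  by their rounded versions costs one rounding error per marginal in the primal integral, and the same again
  in the dual value, as the potential is Lipschitz. On the rounded points primal and dual values
  agree.\<close>

lemma discretised_duality:
  fixes \<mu> \<nu> :: "'a::{second_countable_topology, metric_space} measure"
  assumes l: "0 < l" and \<mu>: "\<mu> \<in> borel_prob_measures" and \<nu>: "\<nu> \<in> borel_prob_measures"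
    and r: "simple_function borel r"
  obtains \<pi> \<psi> where "\<pi> \<in> couplings \<mu> \<nu>" "\<psi> \<in> dual_potentials l"
    and "(\<integral>p. robust_cost l (fst p) (snd p) \<partial>\<pi>) \<le> dual_value \<mu> \<nu> \<psi>
      + 2 * ((\<integral>x. robust_cost l x (r x) \<partial>\<mu>) + (\<integral>x. robust_cost l x (r x) \<partial>\<nu>))"
proof -
  let ?\<rho> = "robust_cost l :: 'a \<Rightarrow> 'a \<Rightarrow> real"
  interpret \<mu>: prob_space \<mu> using \<mu> by (simp add: borel_prob_measures_def)
  interpret \<nu>: prob_space \<nu> using \<nu> by (simp add: borel_prob_measures_def)
  have sets[measurable_cong]: "sets \<mu> = sets borel" "sets \<nu> = sets borel"
    using \<mu> \<nu> by (auto simp: borel_prob_measures_def)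
  have spaces: "space \<mu> = UNIV" "space \<nu> = UNIV"
    using sets_eq_imp_space_eq[OF sets(1)] sets_eq_imp_space_eq[OF sets(2)] by auto
  have rm[measurable]: "r \<in> borel_measurable borel" using r by (rule borel_measurable_simple_function)
  have fib[measurable]: "r -` {a} \<in> sets borel" for a using simple_functionD(2)[OF r, of "{a}"] by simp
  define A where "A = range r"
  have A: "finite A" using simple_functionD(1)[OF r] by (simp add: A_def)
  have rA: "r x \<in> A" for x by (simp add: A_def)
  define p where "p = (\<lambda>a. measure \<mu> (r -` {a}))"
  define q where "q = (\<lambda>a. measure \<nu> (r -` {a}))"
  have pq: "sum p A = 1" "sum q A = 1"
    using sum_measure_fibres[OF \<mu>.finite_measure_axioms A rA, of UNIV]
      sum_measure_fibres[OF \<nu>.finite_measure_axioms A rA, of UNIV] \<mu>.prob_space \<nu>.prob_space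
    by (auto simp: p_def q_def sets spaces)
  obtain w \<psi> where w: "w \<in> finite_plans A p q" and \<psi>: "\<And>x y. \<psi> x - \<psi> y \<le> ?\<rho> x y"
    and eq: "plan_cost A ?\<rho> w = (\<Sum>a\<in>A. \<psi> a * p a) - (\<Sum>a\<in>A. \<psi> a * q a)"
    by (rule finite_kantorovich_rubinstein[where p = p and q = q and c = ?\<rho>,
          OF A _ _ pq robust_cost_self[OF l] robust_cost_triangle[OF l]]) (auto simp: p_def q_def)
  obtain \<pi> where \<pi>: "\<pi> \<in> couplings \<mu> \<nu>"
    and rect: "\<And>a b. a \<in> A \<Longrightarrow> b \<in> A \<Longrightarrow> measure \<pi> (r -` {a} \<times> r -` {b}) = w a b"
    using coupling_of_finite_plan[OF \<mu> \<nu> A rA fib] w unfolding p_def q_def by blast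
  interpret \<pi>: prob_space \<pi> using coupling_facts(1)[OF \<pi>] .
  note [measurable] = coupling_facts(3,4)[OF \<pi>]
  have space_\<pi>: "space \<pi> = UNIV" using sets_eq_imp_space_eq[OF coupling_facts(2)[OF \<pi>]] by simp
  have \<psi>dual: "\<psi> \<in> dual_potentials l" using \<psi> by (simp add: dual_potentials_iff)
  define e where "e = (\<lambda>x. ?\<rho> x (r x))"
  have em[measurable]: "e \<in> borel_measurable borel" unfolding e_def by measurable
  have eint: "integrable \<mu> e" "integrable \<nu> e"
    unfolding e_def using rm
    by (intro robust_cost_integrable l \<mu>.prob_space_axioms \<nu>.prob_space_axioms; simp)+
  note e\<pi> = coupling_integral_marginals[OF \<pi> em]
  have rect_sets: "r -` {a} \<times> r -` {b} \<in> sets \<pi>" for a b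
    unfolding coupling_facts(2)[OF \<pi>] borel_prod[symmetric] by (intro pair_measureI fib)
  define R where "R = (\<lambda>z. (r (fst z), r (snd z)))"
  have R: "R -` {z} = r -` {fst z} \<times> r -` {snd z}" for z by (auto simp: R_def)
  have "(\<integral>z. case_prod ?\<rho> (R z) \<partial>\<pi>)
      = (\<Sum>z\<in>A \<times> A. case_prod ?\<rho> z * measure \<pi> (R -` {z} \<inter> space \<pi>))"
  proof (rule integral_simple_comp[OF \<pi>.finite_measure_axioms])
    show "R -` {z} \<inter> space \<pi> \<in> sets \<pi>" for z
      using rect_sets by (simp add: R space_\<pi>)
  qed (use A rA in \<open>auto simp: R_def\<close>)
  also have "\<dots> = (\<Sum>z\<in>A \<times> A. w (fst z) (snd z) * ?\<rho> (fst z) (snd z))"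
    unfolding R space_\<pi> using rect by (intro sum.cong refl) auto
  finally have "(\<integral>z. ?\<rho> (r (fst z)) (r (snd z)) \<partial>\<pi>) = plan_cost A ?\<rho> w"
    by (simp add: R_def plan_cost_def sum.cartesian_product case_prod_beta)
  also have "\<dots> = (\<integral>x. \<psi> (r x) \<partial>\<mu>) - (\<integral>x. \<psi> (r x) \<partial>\<nu>)"
    using integral_simple_comp[where f = \<psi>, OF \<mu>.finite_measure_axioms A rA]
      integral_simple_comp[where f = \<psi>, OF \<nu>.finite_measure_axioms A rA]
    by (simp add: eq sets spaces p_def q_def)
  finally have cost_r: "(\<integral>z. ?\<rho> (r (fst z)) (r (snd z)) \<partial>\<pi>)
      = (\<integral>x. \<psi> (r x) \<partial>\<mu>) - (\<integral>x. \<psi> (r x) \<partial>\<nu>)" .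
  have "(\<integral>z. ?\<rho> (fst z) (snd z) \<partial>\<pi>)
      \<le> (\<integral>z. e (fst z) + ?\<rho> (r (fst z)) (r (snd z)) + e (snd z) \<partial>\<pi>)"
  proof (intro integral_mono Bochner_Integration.integrable_add)
    fix z
    show "?\<rho> (fst z) (snd z) \<le> e (fst z) + ?\<rho> (r (fst z)) (r (snd z)) + e (snd z)"
      using robust_cost_triangle[OF l, of "fst z" "snd z" "r (fst z)"]
        robust_cost_triangle[OF l, of "r (fst z)" "snd z" "r (snd z)"]
        robust_cost_commute[of l "r (snd z)" "snd z"]
      unfolding e_def by simp
  qed (use e\<pi>(3,4) eint l \<pi>.prob_space_axioms in \<open>auto intro!: robust_cost_integrable\<close>)
  also have "\<dots> = (\<integral>x. e x \<partial>\<mu>) + ((\<integral>x. \<psi> (r x) \<partial>\<mu>) - (\<integral>x. \<psi> (r x) \<partial>\<nu>)) + (\<integral>x. e x \<partial>\<nu>)"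
  proof -
    have "integrable \<pi> (\<lambda>z. ?\<rho> (r (fst z)) (r (snd z)))"
      by (intro robust_cost_integrable l \<pi>.prob_space_axioms) measurable
    then show ?thesis using e\<pi>(3,4) eint by (simp add: e\<pi>(1,2) cost_r)
  qed
  also have "\<dots> \<le> dual_value \<mu> \<nu> \<psi> + 2 * ((\<integral>x. e x \<partial>\<mu>) + (\<integral>x. e x \<partial>\<nu>))"
  proof -
    have \<psi>int: "integrable \<mu> \<psi>" "integrable \<nu> \<psi>"
      using dual_potential_integrable[OF \<psi>dual] \<mu> \<nu> by auto
    have \<psi>m[measurable]: "\<psi> \<in> borel_measurable borel" by (rule dual_potential_measurable[OF \<psi>dual])
    obtain B where B: "\<And>x. norm (\<psi> x) \<le> B"
      using \<psi>dual by (auto simp: dual_potentials_def bcontfun_def bounded_iff)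
    have rint: "integrable \<mu> (\<lambda>x. \<psi> (r x))" "integrable \<nu> (\<lambda>x. \<psi> (r x))"
      using B by (auto intro!: \<mu>.integrable_const_bound[of _ B] \<nu>.integrable_const_bound[of _ B])
    have "(\<integral>x. \<psi> (r x) \<partial>\<mu>) \<le> (\<integral>x. \<psi> x + e x \<partial>\<mu>)"
      using \<psi>[of "r _"] robust_cost_commute[of l "r _"]
      by (intro integral_mono rint Bochner_Integration.integrable_add \<psi>int eint)
        (metis e_def diff_le_eq add.commute)
    moreover have "(\<integral>x. \<psi> x - e x \<partial>\<nu>) \<le> (\<integral>x. \<psi> (r x) \<partial>\<nu>)"
      using \<psi>[of _ "r _"]
      by (intro integral_mono rint Bochner_Integration.integrable_diff \<psi>int eint)
        (metis e_def diff_le_eq add.commute)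
    ultimately show ?thesis using \<psi>int eint by (simp add: dual_value_def)
  qed
  finally show thesis using that[OF \<pi> \<psi>dual] unfolding e_def by blast
qed

lemma simple_functions_approximate_identity:
  obtains r :: "nat \<Rightarrow> 'a::{second_countable_topology, metric_space} \<Rightarrow> 'a"
  where "\<And>n. simple_function borel (r n)" "\<And>x. (\<lambda>n. r n x) \<longlonglongrightarrow> x"
  using borel_measurable_implies_sequence_metric[of "\<lambda>x::'a. x" borel undefined] by auto

lemma integral_robust_cost_tendsto_0:
  fixes M :: "'a::{second_countable_topology, metric_space} measure"
  assumes l: "0 < l" and M: "M \<in> borel_prob_measures"
    and r: "\<And>n. r n \<in> borel_measurable borel" and lim: "\<And>x. (\<lambda>n. r n x) \<longlonglongrightarrow> x"
  shows "(\<lambda>n. \<integral>x. robust_cost l x (r n x) \<partial>M) \<longlonglongrightarrow> 0"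
proof -
  interpret prob_space M using M by (simp add: borel_prob_measures_def)
  have [measurable_cong]: "sets M = sets borel" using M by (simp add: borel_prob_measures_def)
  note [measurable] = r
  have "(\<lambda>n. robust_cost l x (r n x)) \<longlonglongrightarrow> 0" for x
  proof -
    have "(\<lambda>n. robust_cost l x (r n x)) \<longlonglongrightarrow> min (dist x x) (2 * l)"
      unfolding robust_cost_def by (intro tendsto_intros lim)
    then show ?thesis using l by simp
  qed
  then have "(\<lambda>n. \<integral>x. robust_cost l x (r n x) \<partial>M) \<longlonglongrightarrow> (\<integral>x. 0 \<partial>M)"
    by (intro integral_dominated_convergence[where w = "\<lambda>_. 2 * l"]) (auto simp: abs_robust_cost_le[OF l])
  then show ?thesis by simp
qed

section \<open>Attainment and the duality theorem\<close>

lemma dual_value_shift: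
  assumes "\<mu> \<in> borel_prob_measures" "\<nu> \<in> borel_prob_measures" "\<psi> \<in> dual_potentials l"
  shows "dual_value \<mu> \<nu> (\<lambda>x. \<psi> x - t) = dual_value \<mu> \<nu> \<psi>"
proof -
  interpret \<mu>: prob_space \<mu> using assms by (simp add: borel_prob_measures_def)
  interpret \<nu>: prob_space \<nu> using assms by (simp add: borel_prob_measures_def)
  show ?thesis
    using dual_potential_integrable[OF assms(3)] assms(1,2)
    by (simp add: dual_value_def \<mu>.prob_space \<nu>.prob_space)
qed

text \<open>The direct method: constants do not change the dual value, so a maximising sequence may be assumed to
  vanish at a point; it is then uniformly bounded, and a diagonal subsequence
  converges pointwise.\<close>

lemma dual_attained:
  fixes \<mu> \<nu> :: "'a::{second_countable_topology, metric_space} measure"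
  assumes l: "0 < l" and \<mu>: "\<mu> \<in> borel_prob_measures" and \<nu>: "\<nu> \<in> borel_prob_measures"
    and bdd: "bdd_above (dual_value \<mu> \<nu> ` dual_potentials l)"
  shows "\<exists>\<psi>\<in>dual_potentials l. dual_value \<mu> \<nu> \<psi> = (SUP \<psi>'\<in>dual_potentials l. dual_value \<mu> \<nu> \<psi>')"
proof -
  let ?D = "dual_potentials l :: ('a \<Rightarrow> real) set" and ?v = "dual_value \<mu> \<nu>"
  interpret \<mu>: prob_space \<mu> using \<mu> by (simp add: borel_prob_measures_def)
  interpret \<nu>: prob_space \<nu> using \<nu> by (simp add: borel_prob_measures_def)
  have sets[measurable_cong]: "sets \<mu> = sets borel" "sets \<nu> = sets borel"
    using \<mu> \<nu> by (auto simp: borel_prob_measures_def)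
  have "(\<lambda>_. 0) \<in> ?D" by (simp add: dual_potentials_iff robust_cost_nonneg[OF l])
  then have ne: "?v ` ?D \<noteq> {}" by blast
  obtain u where u: "\<And>n. u n \<in> ?v ` ?D" "u \<longlonglongrightarrow> Sup (?v ` ?D)"
    using closure_contains_Sup[OF ne bdd] unfolding closure_sequential by blast
  then have "\<forall>n. \<exists>\<psi>. \<psi> \<in> ?D \<and> u n = ?v \<psi>" by blast
  then obtain \<Psi> where \<Psi>: "\<And>n. \<Psi> n \<in> ?D" "\<And>n. u n = ?v (\<Psi> n)" by metis
  define F where "F = (\<lambda>n x. \<Psi> n x - \<Psi> n undefined)"
  have F_lip: "F n x - F n y \<le> robust_cost l x y" for n x y
    using \<Psi>(1)[of n] by (simp add: F_def dual_potentials_iff)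
  then have FD: "F n \<in> ?D" for n by (simp add: dual_potentials_iff)
  have F_value: "?v (F n) = u n" for n
    using dual_value_shift[OF \<mu> \<nu> \<Psi>(1)] \<Psi>(2) by (simp add: F_def)
  have F_abs: "\<bar>F n x\<bar> \<le> 2 * l" for n x
    using F_lip[of n x undefined] F_lip[of n undefined x] robust_cost_le[of l]
    by (auto simp: F_def abs_le_iff intro: order.trans)
  obtain S :: "'a set" where S: "countable S" "\<And>X. open X \<Longrightarrow> X \<noteq> {} \<Longrightarrow> \<exists>d\<in>S. d \<in> X"
    using countable_dense_setE by blast
  obtain k :: "nat \<Rightarrow> nat" where k: "strict_mono k"
    and conv: "\<And>x. x \<in> S \<Longrightarrow> \<exists>l. (\<lambda>n. F (k n) x) \<longlonglongrightarrow> l"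
    using function_convergent_subsequence[OF S(1), of F "2 * l"] F_abs by auto
  \<comment> \<open>Equicontinuity carries convergence from the dense set to every point.\<close>
  have "convergent (\<lambda>n. F (k n) x)" for x
    unfolding Cauchy_convergent_iff[symmetric]
  proof (rule metric_CauchyI)
    fix \<epsilon> :: real assume "0 < \<epsilon>"
    then obtain d where d: "d \<in> S" "dist x d < \<epsilon> / 3"
      using S(2)[of "ball x (\<epsilon> / 3)"] by auto
    have close: "\<bar>F n x - F n d\<bar> < \<epsilon> / 3" for n
      using F_lip[of n x d] F_lip[of n d x] d(2) unfolding robust_cost_def dist_commute[of d x] by linarith
    from conv[OF d(1)] have "Cauchy (\<lambda>n. F (k n) d)" by (auto simp: Cauchy_convergent_iff convergent_def)
    then obtain N where N: "\<And>m n. m \<ge> N \<Longrightarrow> n \<ge> N \<Longrightarrow> dist (F (k m) d) (F (k n) d) < \<epsilon> / 3"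
      using \<open>0 < \<epsilon>\<close> by (meson divide_pos_pos metric_CauchyD zero_less_numeral)
    have "dist (F (k m) x) (F (k n) x) < \<epsilon>" if "m \<ge> N" "n \<ge> N" for m n
      using N[OF that] close[of "k m"] close[of "k n"] unfolding dist_real_def by linarith
    then show "\<exists>N. \<forall>m\<ge>N. \<forall>n\<ge>N. dist (F (k m) x) (F (k n) x) < \<epsilon>" by blast
  qed
  then obtain \<psi> where lim: "\<And>x. (\<lambda>n. F (k n) x) \<longlonglongrightarrow> \<psi> x" unfolding convergent_def by metis
  have "\<psi> x - \<psi> y \<le> robust_cost l x y" for x y
    by (rule LIMSEQ_le_const2[OF tendsto_diff[OF lim lim]]) (use F_lip in auto)
  then have \<psi>D: "\<psi> \<in> ?D" by (simp add: dual_potentials_iff)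
  note [measurable] = dual_potential_measurable[OF \<psi>D] dual_potential_measurable[OF FD]
  have "(\<lambda>n. \<integral>x. F (k n) x \<partial>\<mu>) \<longlonglongrightarrow> (\<integral>x. \<psi> x \<partial>\<mu>)"
    using lim F_abs by (intro integral_dominated_convergence[where w = "\<lambda>_. 2 * l"]) auto
  moreover have "(\<lambda>n. \<integral>x. F (k n) x \<partial>\<nu>) \<longlonglongrightarrow> (\<integral>x. \<psi> x \<partial>\<nu>)"
    using lim F_abs by (intro integral_dominated_convergence[where w = "\<lambda>_. 2 * l"]) auto
  ultimately have "(\<lambda>n. ?v (F (k n))) \<longlonglongrightarrow> ?v \<psi>"
    unfolding dual_value_def by (rule tendsto_diff)
  moreover have "(\<lambda>n. ?v (F (k n))) \<longlonglongrightarrow> Sup (?v ` ?D)"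
    using LIMSEQ_subseq_LIMSEQ[OF u(2) k] by (simp add: F_value o_def)
  ultimately show ?thesis using \<psi>D LIMSEQ_unique by blast
qed

theorem theorem2p1:
  fixes \<mu> \<nu> :: "'a::polish_space measure" and l :: real
  assumes "l > 0"
    and "\<mu> \<in> borel_prob_measures" and "\<nu> \<in> borel_prob_measures"
  shows "(\<forall>\<psi> :: 'a \<Rightarrow> ereal. c_convex (robust_cost l) \<psi> \<longrightarrow>
            (\<forall>x. c_transform (robust_cost l) \<psi> x = \<psi> x))
       \<and> (INF \<pi>\<in>couplings \<mu> \<nu>. \<integral>p. robust_cost l (fst p) (snd p) \<partial>\<pi>)
            = (SUP \<psi>\<in>dual_potentials l. dual_value \<mu> \<nu> \<psi>)
       \<and> (\<exists>\<psi>\<in>dual_potentials l.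
            dual_value \<mu> \<nu> \<psi> = (SUP \<psi>'\<in>dual_potentials l. dual_value \<mu> \<nu> \<psi>'))"
proof (intro conjI allI impI)
  fix \<psi> :: "'a \<Rightarrow> ereal" and x
  assume "c_convex (robust_cost l) \<psi>"
  then show "c_transform (robust_cost l) \<psi> x = \<psi> x"
    by (rule c_transform_of_c_convex[OF _ robust_cost_self[OF \<open>l > 0\<close>]
          robust_cost_triangle[OF \<open>l > 0\<close>]])
next
  let ?cost = "\<lambda>\<pi>. \<integral>p. robust_cost l (fst p) (snd p) \<partial>\<pi>"
  let ?I = "INF \<pi>\<in>couplings \<mu> \<nu>. ?cost \<pi>" and ?S = "SUP \<psi>\<in>dual_potentials l. dual_value \<mu> \<nu> \<psi>"
  note weak = weak_duality[OF assms]
  obtain r :: "nat \<Rightarrow> 'a \<Rightarrow> 'a" where r: "\<And>n. simple_function borel (r n)" and lim: "\<And>x. (\<lambda>n. r n x) \<longlonglongrightarrow> x"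
    by (rule simple_functions_approximate_identity) blast
  obtain \<pi>0 and \<psi>0 :: "'a \<Rightarrow> real" where ne: "\<pi>0 \<in> couplings \<mu> \<nu>" "\<psi>0 \<in> dual_potentials l"
    by (rule discretised_duality[OF assms r[of 0]]) blast
  have bddI: "bdd_below (?cost ` couplings \<mu> \<nu>)" using weak[OF _ ne(2)] by (intro bdd_belowI2)
  have bddS: "bdd_above (dual_value \<mu> \<nu> ` dual_potentials l)" using weak[OF ne(1)] by (intro bdd_aboveI2)
  show "\<exists>\<psi>\<in>dual_potentials l. dual_value \<mu> \<nu> \<psi> = ?S" by (rule dual_attained[OF assms bddS])
  show "?I = ?S"
  proof (rule antisym)
    define E where "E = (\<lambda>n. 2 * ((\<integral>x. robust_cost l x (r n x) \<partial>\<mu>) + (\<integral>x. robust_cost l x (r n x) \<partial>\<nu>)))"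
    have "E \<longlonglongrightarrow> 2 * (0 + 0)"
      unfolding E_def using r lim assms
      by (intro tendsto_intros integral_robust_cost_tendsto_0 borel_measurable_simple_function) auto
    then have "(\<lambda>n. ?S + E n) \<longlonglongrightarrow> ?S" using tendsto_add[OF tendsto_const, of E 0 _ ?S] by simp
    moreover have "?I \<le> ?S + E n" for n
    proof -
      obtain \<pi> \<psi> where "\<pi> \<in> couplings \<mu> \<nu>" "\<psi> \<in> dual_potentials l" "?cost \<pi> \<le> dual_value \<mu> \<nu> \<psi> + E n"
        unfolding E_def by (rule discretised_duality[OF assms r])
      with cINF_lower[OF bddI] cSUP_upper[OF _ bddS] show ?thesis by fastforce
    qed
    ultimately show "?I \<le> ?S" by (intro LIMSEQ_le_const) auto
    show "?S \<le> ?I"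
      using ne weak by (intro cSUP_least cINF_greatest) auto
  qed
qed

end
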